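(* Let $G$ be a topological group, $n\in\mathbb N$ (so $n\ge 1$), and let $\mathcal I$ be a $\sigma$-ideal on $G$ which has the closed $\pm n$-Steinhaus property. Then $\mathcal I$ contains every meager quasi-analytic subgroup of $G$ and every non-open analytic subgroup of $G$.
   Context: A non-empty family $\mathcal I$ of subsets of a set $X$ is an ideal on $X$ if it is closed under taking subsets and finite unions; it is a $\sigma$-ideal if it is closed under countable unions. For subsets $A_1,\dots,A_n$ of a group, $A_1\cdots A_n=\{a_1\cdots a_n: a_i\in A_i\}$; also $A^{-1}=\{a^{-1}:a\in A\}$ and $A^{\pm}=A\cup A^{-1}$. An ideal $\mathcal I$ on a topological group $G$ has the closed $\pm n$-Steinhaus property if for any closed subsets $A_1,\dots,A_n\notin\mathcal I$ of $G$ the product $A_1^{\pm}\cdots A_n^{\pm}$ is not nowhere dense in $G$. A topological space is Baire if every countable intersection of open dense subsets is dense; hereditarily Baire if each closed subspace is Baire; quasi-analytic if it is a continuous image of a hereditarily Baire metrizable separable space; analytic if it is a continuous image of a Polish space. Subgroups are called quasi-analytic or analytic with respect to the subspace topology; a subgroup is meager if it is meager as a subset of $G$.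
   Formalization: For the claim on non-open analytic subgroups, G is additionally assumed Hausdorff; without this the claim fails (G nontrivial indiscrete, ideal {∅}, subgroup {1}). The claim on meager quasi-analytic subgroups is unrestricted. *)

theory Defs
  imports "HOL-Analysis.Analysis" "HOL-Algebra.Coset"
begin

text \<open>No separation axiom is built in.\<close>

locale topological_group = group G for G (structure) +
  fixes T :: "'a topology"
  assumes topspace_eq_carrier: "topspace T = carrier G"
    and continuous_mult: "continuous_map (prod_topology T T) T (\<lambda>(x, y). x \<otimes> y)"
    and continuous_inv: "continuous_map T T (\<lambda>x. inv x)"

definition set_ideal :: "'a set \<Rightarrow> 'a set set \<Rightarrow> bool" where
  "set_ideal X I \<longleftrightarrow> I \<noteq> {} \<and> I \<subseteq> Pow X \<and>
     (\<forall>A\<in>I. \<forall>B. B \<subseteq> A \<longrightarrow> B \<in> I) \<and>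
     (\<forall>A\<in>I. \<forall>B\<in>I. A \<union> B \<in> I)"

definition set_sigma_ideal :: "'a set \<Rightarrow> 'a set set \<Rightarrow> bool" where
  "set_sigma_ideal X I \<longleftrightarrow> set_ideal X I \<and> (\<forall>F. countable F \<and> F \<subseteq> I \<longrightarrow> \<Union>F \<in> I)"

definition nowhere_dense_in :: "'a topology \<Rightarrow> 'a set \<Rightarrow> bool" where
  "nowhere_dense_in X A \<longleftrightarrow> A \<subseteq> topspace X \<and> X interior_of (X closure_of A) = {}"

definition meager_in :: "'a topology \<Rightarrow> 'a set \<Rightarrow> bool" where
  "meager_in X A \<longleftrightarrow> (\<exists>F. countable F \<and> (\<forall>N\<in>F. nowhere_dense_in X N) \<and> A = \<Union>F)"

definition pm_set :: "('a, 'b) monoid_scheme \<Rightarrow> 'a set \<Rightarrow> 'a set" where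
  "pm_set G A = A \<union> set_inv\<^bsub>G\<^esub> A"

definition list_set_mult :: "('a, 'b) monoid_scheme \<Rightarrow> 'a set list \<Rightarrow> 'a set" where
  "list_set_mult G As = foldr (\<lambda>A B. A <#>\<^bsub>G\<^esub> B) As {\<one>\<^bsub>G\<^esub>}"

definition closed_pm_Steinhaus ::
    "('a, 'b) monoid_scheme \<Rightarrow> 'a topology \<Rightarrow> nat \<Rightarrow> 'a set set \<Rightarrow> bool" where
  "closed_pm_Steinhaus G T n I \<longleftrightarrow>
     (\<forall>As. length As = n \<and> (\<forall>A\<in>set As. closedin T A \<and> A \<notin> I) \<longrightarrow>
        \<not> nowhere_dense_in T (list_set_mult G (map (pm_set G) As)))"

definition Baire_space :: "'a topology \<Rightarrow> bool" where
  "Baire_space X \<longleftrightarrow>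
     (\<forall>U :: nat \<Rightarrow> 'a set. (\<forall>k. openin X (U k) \<and> X closure_of (U k) = topspace X) \<longrightarrow>
        X closure_of (\<Inter>k. U k) = topspace X)"

definition hereditarily_Baire_space :: "'a topology \<Rightarrow> bool" where
  "hereditarily_Baire_space X \<longleftrightarrow> (\<forall>C. closedin X C \<longrightarrow> Baire_space (subtopology X C))"

definition Polish_space :: "'a topology \<Rightarrow> bool" where
  "Polish_space X \<longleftrightarrow> completely_metrizable_space X \<and> separable_space X"

definition continuous_image_of :: "'a topology \<Rightarrow> 'z topology \<Rightarrow> bool" where
  "continuous_image_of X Z \<longleftrightarrow> (\<exists>f. continuous_map Z X f \<and> f ` topspace Z = topspace X)"

text \<open>
  A definition cannot quantify over types, so the type carrying the parametrizing space
  is an explicit argument. Since both notions occur only as hypotheses, a free type variable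
  in that position amounts to an arbitrary parametrizing space.
\<close>

definition quasi_analytic_space :: "'z itself \<Rightarrow> 'a topology \<Rightarrow> bool" where
  "quasi_analytic_space _ X \<longleftrightarrow>
     (\<exists>Z :: 'z topology. hereditarily_Baire_space Z \<and> metrizable_space Z \<and> separable_space Z \<and>
        continuous_image_of X Z)"

definition analytic_space :: "'z itself \<Rightarrow> 'a topology \<Rightarrow> bool" where
  "analytic_space _ X \<longleftrightarrow> (\<exists>Z :: 'z topology. Polish_space Z \<and> continuous_image_of X Z)"

end

theory Submission
  imports Defs
begin

text \<open>
  Let \<open>f : Z \<rightarrow> G\<close> parametrize a subgroup \<open>H\<close>, and suppose that \<open>H \<notin> I\<close>. As \<open>Z\<close> is second countable,
  the union of all open sets with image in \<open>I\<close> still has its image in \<open>I\<close>. Removing it leaves a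
  non-empty closed kernel \<open>C \<subseteq> Z\<close>, a Baire space, all of whose non-empty open subsets have images
  outside \<open>I\<close> (\<open>sigma_ideal_kernel\<close>).

  If \<open>H\<close> is meager, it is covered by an increasing sequence of closed nowhere dense sets \<open>N k\<close>.
  It suffices to find non-empty open \<open>V\<^sub>1, \<dots>, V\<^sub>n \<subseteq> C\<close> for which the product of the sets
  \<open>(closure (f V\<^sub>i))\<^sup>\<plusminus>\<close> lies in one \<open>N k\<close>: the closures are closed sets outside \<open>I\<close> whose product is
  nowhere dense, against the Steinhaus property. These \<open>V\<^sub>i\<close> come from a Kuratowski-Ulam argument by
  induction on \<open>n\<close> (\<open>pm_product_of_closures_in_closed_cover\<close>). Fixing the first coordinate \<open>z\<close> and
  applying the induction hypothesis to the translated cover \<open>f(z)\<^sup>-\<^sup>1 N k \<inter> f(z) N k\<close> of \<open>H\<close> gives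
  suitable \<open>V\<^sub>2, \<dots>, V\<^sub>n\<close> from a countable base and an index \<open>k\<close>. Only countably many such data
  exist, each of them works for a closed set of \<open>z\<close>, and hence by the Baire property one of them
  works for all \<open>z\<close> in an open set \<open>V\<^sub>1\<close>. No product of Baire spaces is formed, and both signs of
  every factor are treated at once.

  For analytic \<open>H\<close> it remains to see that a non-meager \<open>H\<close> is open. Now take the kernel \<open>C\<close> for the
  ideal of meager sets. The set \<open>f C\<close> is non-meager, and by completeness of \<open>C\<close> it differs from its
  closure by a meager set (\<open>nonmeager_parametrization_almost_closed\<close>, a form of the theorem that
  analytic sets have the Baire property). So \<open>H\<close> is comeager in some non-empty open set \<open>U\<close>, and
  the classical argument of Pettis shows that \<open>U \<subseteq> H\<close>
  (\<open>nonmeager_analytic_subgroup_open\<close>).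
\<close>

section \<open>Separable metrizable spaces and Baire spaces\<close>

lemma separable_metrizable_imp_second_countable:
  assumes "metrizable_space X" "separable_space X"
  shows "second_countable X"
proof -
  obtain M d where "Metric_space M d" and X: "X = Metric_space.mtopology M d"
    using assms(1) unfolding metrizable_space_def by blast
  then interpret Metric_space M d
    by blast
  obtain D where D: "countable D" "D \<subseteq> M" and dense: "mtopology closure_of D = M"
    using assms(2) unfolding separable_space_def X by auto
  define \<B> where "\<B> = (\<lambda>(a, k). mball a (1 / real (Suc k))) ` (D \<times> (UNIV :: nat set))"
  have "countable \<B>"
    unfolding \<B>_def using D(1) by blast
  moreover have "openin mtopology V" if "V \<in> \<B>" for V
    using that unfolding \<B>_def by auto
  moreover have "\<exists>V\<in>\<B>. x \<in> V \<and> V \<subseteq> U" if U: "openin mtopology U" and x: "x \<in> U" for U x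
  proof -
    obtain r where r: "r > 0" "mball x r \<subseteq> U" and xM: "x \<in> M"
      using U x unfolding openin_mtopology by blast
    obtain k where k: "1 / real (Suc k) < r / 2"
      using r(1) by (meson half_gt_zero nat_approx_posE)
    have "x \<in> mtopology closure_of D"
      using xM dense by simp
    then obtain a where a: "a \<in> D" "a \<in> mball x (1 / real (Suc k))"
      unfolding metric_closure_of using zero_less_divide_1_iff of_nat_0_less_iff zero_less_Suc by blast
    have "mball a (1 / real (Suc k)) \<subseteq> mball x r"
    proof
      fix y assume y: "y \<in> mball a (1 / real (Suc k))"
      then have "d x y \<le> d x a + d a y"
        using a xM D(2) by (intro triangle) auto
      then show "y \<in> mball x r"
        using y a k xM by (auto simp del: of_nat_Suc)
    qed
    moreover have "x \<in> mball a (1 / real (Suc k))"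
      using a xM commute by (auto simp del: of_nat_Suc)
    ultimately show ?thesis
      unfolding \<B>_def using a(1) r(2) by (intro bexI[of _ "mball a (1 / real (Suc k))"]) auto
  qed
  ultimately show ?thesis
    unfolding second_countable_def X by blast
qed

lemma second_countable_baseE:
  assumes "second_countable X"
  obtains \<B> where "countable \<B>" "\<And>V. V \<in> \<B> \<Longrightarrow> openin X V"
    "\<And>U x. \<lbrakk>openin X U; x \<in> U\<rbrakk> \<Longrightarrow> \<exists>V\<in>\<B>. x \<in> V \<and> V \<subseteq> U"
proof -
  obtain \<B> where \<B>: "countable \<B> \<and> (\<forall>V\<in>\<B>. openin X V) \<and>
      (\<forall>U x. openin X U \<and> x \<in> U \<longrightarrow> (\<exists>V\<in>\<B>. x \<in> V \<and> V \<subseteq> U))"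
    using assms unfolding second_countable_def by (rule exE)
  show thesis
  proof (rule that)
    show "countable \<B>"
      using \<B> by (rule conjunct1)
    show "openin X V" if "V \<in> \<B>" for V
      using \<B> that by simp
    show "\<exists>V\<in>\<B>. x \<in> V \<and> V \<subseteq> U" if "openin X U" "x \<in> U" for U x
      using \<B> that by simp
  qed
qed

lemma completely_metrizable_imp_Baire_space:
  assumes "completely_metrizable_space X"
  shows "Baire_space X"
  unfolding Baire_space_def
proof (intro allI impI)
  fix U :: "nat \<Rightarrow> 'a set"
  assume "\<forall>k. openin X (U k) \<and> X closure_of U k = topspace X"
  then show "X closure_of (\<Inter>k. U k) = topspace X"
    using Baire_category[of X "range U"] assms by auto
qed

lemma Polish_imp_hereditarily_Baire:
  assumes "Polish_space X"
  shows "hereditarily_Baire_space X"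
  using assms completely_metrizable_imp_Baire_space completely_metrizable_space_closedin
  unfolding Polish_space_def hereditarily_Baire_space_def by blast

lemma Baire_space_countable_closed_cover:
  assumes X: "Baire_space X" "topspace X \<noteq> {}"
    and J: "countable J" and closed: "\<And>j. j \<in> J \<Longrightarrow> closedin X (F j)"
    and cover: "topspace X \<subseteq> (\<Union>j\<in>J. F j)"
  obtains j where "j \<in> J" "X interior_of (F j) \<noteq> {}"
proof (rule ccontr)
  assume contra: "\<not> thesis"
  have "J \<noteq> {}"
    using X(2) cover by blast
  then have e: "range (from_nat_into J) = J"
    using J by (simp add: range_from_nat_into)
  define U where "U k = topspace X - F (from_nat_into J k)" for k
  have "openin X (U k) \<and> X closure_of (U k) = topspace X" for k
  proof -
    have "from_nat_into J k \<in> J"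
      using e by blast
    then show ?thesis
      using closed contra that
      by (auto simp: U_def closure_of_complement)
  qed
  then have "X closure_of (\<Inter>k. U k) = topspace X"
    using X(1) unfolding Baire_space_def by blast
  moreover have "(\<Inter>k. U k) = {}"
  proof -
    have "\<exists>k. x \<notin> U k" for x
    proof (cases "x \<in> topspace X")
      case True
      then obtain j where "j \<in> J" "x \<in> F j"
        using cover by blast
      moreover obtain k where "from_nat_into J k = j"
        using e \<open>j \<in> J\<close> by (metis rangeE)
      ultimately show ?thesis
        unfolding U_def by blast
    qed (auto simp: U_def)
    then show ?thesis by blast
  qed
  ultimately show False
    using X(2) by simp
qed

section \<open>The kernel of a parametrization relative to a sigma-ideal\<close>

lemma set_sigma_ideal_subset:
  "\<lbrakk>set_sigma_ideal X J; A \<in> J; B \<subseteq> A\<rbrakk> \<Longrightarrow> B \<in> J"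
  unfolding set_sigma_ideal_def set_ideal_def by blast

lemma set_sigma_ideal_Un:
  "\<lbrakk>set_sigma_ideal X J; A \<in> J; B \<in> J\<rbrakk> \<Longrightarrow> A \<union> B \<in> J"
  unfolding set_sigma_ideal_def set_ideal_def by blast

lemma set_sigma_ideal_UN:
  "\<lbrakk>set_sigma_ideal X J; countable K; \<And>k. k \<in> K \<Longrightarrow> A k \<in> J\<rbrakk> \<Longrightarrow> (\<Union>k\<in>K. A k) \<in> J"
  unfolding set_sigma_ideal_def by (metis countable_image image_subset_iff)

text \<open>
  The kernel \<open>C\<close> is the complement of the largest open set with image in the ideal; that set is the
  union of its members of a countable base, so its image stays in the ideal. The lemma serves both
  the given ideal and the ideal of meager sets.
\<close>

lemma sigma_ideal_kernel:
  assumes J: "set_sigma_ideal X J" and Z: "second_countable Z"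
  obtains C where "closedin Z C" "f ` (topspace Z - C) \<in> J"
    "\<And>V. \<lbrakk>openin (subtopology Z C) V; f ` V \<in> J\<rbrakk> \<Longrightarrow> V = {}"
proof -
  obtain \<B> where \<B>: "countable \<B>" "\<And>V. V \<in> \<B> \<Longrightarrow> openin Z V"
    and base: "\<And>U x. \<lbrakk>openin Z U; x \<in> U\<rbrakk> \<Longrightarrow> \<exists>V\<in>\<B>. x \<in> V \<and> V \<subseteq> U"
    using second_countable_baseE[OF Z] by metis
  define \<B>\<^sub>0 where "\<B>\<^sub>0 = {V \<in> \<B>. f ` V \<in> J}"
  define C where "C = topspace Z - \<Union>\<B>\<^sub>0"
  have "openin Z (\<Union>\<B>\<^sub>0)"
    using \<B>(2) unfolding \<B>\<^sub>0_def by blast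
  then have C: "closedin Z C"
    unfolding C_def by blast
  have "f ` \<Union>\<B>\<^sub>0 = (\<Union>V\<in>\<B>\<^sub>0. f ` V)"
    by blast
  also have "\<dots> \<in> J"
    using \<B>(1) by (intro set_sigma_ideal_UN[OF J]) (auto simp: \<B>\<^sub>0_def)
  finally have small: "f ` \<Union>\<B>\<^sub>0 \<in> J" .
  have "f ` (topspace Z - C) \<in> J"
    by (rule set_sigma_ideal_subset[OF J small]) (auto simp: C_def)
  moreover have "V = {}" if V: "openin (subtopology Z C) V" "f ` V \<in> J" for V
  proof (rule ccontr)
    assume "V \<noteq> {}"
    then obtain z where z: "z \<in> V"
      by blast
    obtain W where W: "openin Z W" "V = W \<inter> C"
      using V(1) unfolding openin_subtopology by blast
    obtain W' where W': "W' \<in> \<B>" "z \<in> W'" "W' \<subseteq> W"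
      using base[OF W(1)] z W(2) by blast
    have "W' \<subseteq> V \<union> \<Union>\<B>\<^sub>0"
      using W(2) W'(3) openin_subset[OF \<B>(2)[OF W'(1)]] unfolding C_def by blast
    then have "f ` W' \<subseteq> f ` V \<union> f ` \<Union>\<B>\<^sub>0"
      by blast
    then have "f ` W' \<in> J"
      using set_sigma_ideal_subset[OF J] set_sigma_ideal_Un[OF J V(2) small] by blast
    then have "W' \<in> \<B>\<^sub>0"
      using W'(1) unfolding \<B>\<^sub>0_def by blast
    then show False
      using z W(2) W'(2) unfolding C_def by blast
  qed
  ultimately show ?thesis
    using that C by blast
qed

section \<open>Meager sets\<close>

lemma nowhere_dense_in_subset:
  "\<lbrakk>nowhere_dense_in X A; B \<subseteq> A\<rbrakk> \<Longrightarrow> nowhere_dense_in X B"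
  unfolding nowhere_dense_in_def
  by (metis closure_of_mono interior_of_mono order_trans subset_empty)

lemma nowhere_dense_imp_meager_in:
  "nowhere_dense_in X A \<Longrightarrow> meager_in X A"
  unfolding meager_in_def by (intro exI[of _ "{A}"]) auto

lemma meager_in_subset:
  assumes "meager_in X A" "B \<subseteq> A"
  shows "meager_in X B"
proof -
  obtain F where F: "countable F" "\<forall>N\<in>F. nowhere_dense_in X N" "A = \<Union>F"
    using assms(1) unfolding meager_in_def by blast
  have "countable ((\<lambda>N. N \<inter> B) ` F)" "B = \<Union>((\<lambda>N. N \<inter> B) ` F)"
    using F assms(2) by auto
  moreover have "\<forall>N\<in>(\<lambda>N. N \<inter> B) ` F. nowhere_dense_in X N"
    using F(2) nowhere_dense_in_subset by blast
  ultimately show ?thesis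
    unfolding meager_in_def by blast
qed

lemma meager_in_Union:
  assumes "countable S" "\<And>A. A \<in> S \<Longrightarrow> meager_in X A"
  shows "meager_in X (\<Union>S)"
proof -
  have "\<forall>A\<in>S. \<exists>F. countable F \<and> (\<forall>N\<in>F. nowhere_dense_in X N) \<and> A = \<Union>F"
    using assms(2) unfolding meager_in_def by blast
  then obtain F where F: "\<And>A. A \<in> S \<Longrightarrow> countable (F A) \<and> (\<forall>N\<in>F A. nowhere_dense_in X N) \<and> A = \<Union>(F A)"
    by metis
  have "countable (\<Union>A\<in>S. F A)" "\<forall>N\<in>(\<Union>A\<in>S. F A). nowhere_dense_in X N"
    using F assms(1) by auto
  moreover have "\<Union>S = \<Union>(\<Union>A\<in>S. F A)"
  proof -
    have "\<Union>S = (\<Union>A\<in>S. \<Union>(F A))"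
      using F by simp
    then show ?thesis
      by blast
  qed
  ultimately show ?thesis
    unfolding meager_in_def by blast
qed

lemma meager_in_UN:
  "\<lbrakk>countable K; \<And>k. k \<in> K \<Longrightarrow> meager_in X (A k)\<rbrakk> \<Longrightarrow> meager_in X (\<Union>k\<in>K. A k)"
  by (rule meager_in_Union) auto

lemma meager_in_Un: "\<lbrakk>meager_in X A; meager_in X B\<rbrakk> \<Longrightarrow> meager_in X (A \<union> B)"
  using meager_in_Union[of "{A, B}" X] by auto

lemma meager_sigma_ideal: "set_sigma_ideal (topspace X) {A. meager_in X A}"
proof -
  have "meager_in X {}"
    using meager_in_Union[of "{}"] by simp
  moreover have "A \<subseteq> topspace X" if "meager_in X A" for A
    using that unfolding meager_in_def nowhere_dense_in_def by blast
  ultimately show ?thesis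
    unfolding set_sigma_ideal_def set_ideal_def
    by (auto intro: meager_in_subset meager_in_Un meager_in_Union)
qed

text \<open>
  The cover is made increasing so that finitely many points of \<open>A\<close> always lie in a common member;
  this makes it possible to handle an element and its inverse at the same time later on.
\<close>

lemma meager_in_increasing_closed_cover:
  assumes "meager_in X A"
  obtains N :: "nat \<Rightarrow> 'a set"
  where "incseq N" "\<And>k. closedin X (N k)" "\<And>k. nowhere_dense_in X (N k)" "A \<subseteq> (\<Union>k. N k)"
proof -
  obtain F where F: "countable F" "\<forall>N\<in>F. nowhere_dense_in X N" "A = \<Union>F"
    using assms unfolding meager_in_def by blast
  \<comment> \<open>The empty set is added to have an enumeration also when \<open>F\<close> is empty.\<close>
  define e where "e = from_nat_into (insert {} F)"
  have e: "range e = insert {} F"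
    unfolding e_def using F(1) by (simp add: range_from_nat_into)
  define N where "N k = (\<Union>i\<le>k. X closure_of (e i))" for k
  have nd: "nowhere_dense_in X (e i)" for i
    using F(2) e by (metis insertE interior_of_empty closure_of_empty empty_subsetI nowhere_dense_in_def rangeI)
  have closed: "closedin X (N k)" for k
    unfolding N_def by (intro closedin_Union) auto
  have "X interior_of (N k) = {}" for k
  proof (induction k)
    case 0
    then show ?case
      using nd[of 0] by (simp add: N_def nowhere_dense_in_def)
  next
    case (Suc k)
    have "N (Suc k) = N k \<union> X closure_of (e (Suc k))"
      by (auto simp: N_def atMost_Suc)
    then show ?case
      using Suc nd[of "Suc k"] closed[of k] by (simp add: nowhere_dense_in_def interior_of_union_eq_empty)
  qed
  then have "nowhere_dense_in X (N k)" for k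
    using closed[of k] by (simp add: nowhere_dense_in_def closure_of_closedin closedin_subset)
  moreover have "incseq N"
    unfolding N_def incseq_def by fastforce
  moreover have "A \<subseteq> (\<Union>k. N k)"
  proof
    fix x assume "x \<in> A"
    then obtain i where "x \<in> e i"
      using F(3) e by (metis UnionE insertI2 rangeE)
    moreover have "e i \<subseteq> topspace X"
      using nd unfolding nowhere_dense_in_def by blast
    ultimately have "x \<in> N i"
      unfolding N_def using closure_of_subset by fast
    then show "x \<in> (\<Union>k. N k)"
      by blast
  qed
  ultimately show ?thesis
    using that closed by blast
qed

lemma closed_minus_interior_nowhere_dense:
  assumes "closedin X A"
  shows "nowhere_dense_in X (A - X interior_of A)"
proof -
  have "closedin X (A - X interior_of A)"
    using assms by (intro closedin_diff) auto
  moreover have "X interior_of (A - X interior_of A) = {}"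
  proof -
    have "X interior_of (A - X interior_of A) \<subseteq> X interior_of A"
      by (intro interior_of_mono) blast
    then show ?thesis
      using interior_of_subset[of X "A - X interior_of A"] by blast
  qed
  ultimately show ?thesis
    by (simp add: nowhere_dense_in_def closure_of_closedin closedin_subset)
qed

lemma homeomorphic_map_nowhere_dense_in:
  assumes "homeomorphic_map X Y f" "nowhere_dense_in X A"
  shows "nowhere_dense_in Y (f ` A)"
proof -
  have A: "A \<subseteq> topspace X" "X interior_of (X closure_of A) = {}"
    using assms(2) by (auto simp: nowhere_dense_in_def)
  have "Y interior_of (Y closure_of (f ` A)) = f ` (X interior_of (X closure_of A))"
    using homeomorphic_map_closure_of[OF assms(1) A(1)]
      homeomorphic_map_interior_of[OF assms(1) closure_of_subset_topspace] by simp
  moreover have "f ` A \<subseteq> topspace Y"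
    using A(1) homeomorphic_imp_surjective_map[OF assms(1)] by blast
  ultimately show ?thesis
    using A(2) by (simp add: nowhere_dense_in_def)
qed

lemma homeomorphic_map_meager_in:
  assumes "homeomorphic_map X Y f" "meager_in X A"
  shows "meager_in Y (f ` A)"
proof -
  obtain F where F: "countable F" "\<forall>N\<in>F. nowhere_dense_in X N" "A = \<Union>F"
    using assms(2) unfolding meager_in_def by blast
  have "countable ((`) f ` F)" "f ` A = \<Union>((`) f ` F)"
    using F by auto
  moreover have "\<forall>N\<in>(`) f ` F. nowhere_dense_in Y N"
    using F(2) assms(1) homeomorphic_map_nowhere_dense_in by blast
  ultimately show ?thesis
    unfolding meager_in_def by blast
qed

section \<open>Continuous images of complete spaces are almost closed\<close>

text \<open>
  For an open set \<open>W\<close> of parameters and a countable cover of \<open>W\<close> by small open subsets \<open>V\<close>, the set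
  \<open>closure (f W) - (\<Union>V. interior (closure (f V)))\<close> is nowhere dense: on an open set contained in it,
  \<open>f W\<close> would be covered by the nowhere dense boundaries of the sets \<open>closure (f V)\<close>, whereas the
  part of \<open>f W\<close> in that open set is the image of a non-empty open set of parameters. A point \<open>x\<close> of the
  closure of the whole image that avoids all these countably many exceptional sets can be followed
  down: there are nested \<open>W\<^sub>0 \<supseteq> W\<^sub>1 \<supseteq> \<dots>\<close> with diameters tending to \<open>0\<close> and
  \<open>x \<in> closure (f W\<^sub>n)\<close> for all \<open>n\<close>. By completeness the \<open>W\<^sub>n\<close> shrink to a point \<open>z\<close>, and
  \<open>f z = x\<close> because points of \<open>X\<close> can be separated.
\<close>

lemma nonmeager_parametrization_almost_closed:
  assumes Z: "completely_metrizable_space Z" "second_countable Z" and X: "Hausdorff_space X"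
    and f: "continuous_map Z X f"
    and big: "\<And>V. \<lbrakk>openin Z V; meager_in X (f ` V)\<rbrakk> \<Longrightarrow> V = {}"
  shows "meager_in X (X closure_of (f ` topspace Z) - f ` topspace Z)"
proof -
  obtain M d where "Metric_space M d" and complete: "Metric_space.mcomplete M d"
    and Zeq: "Z = Metric_space.mtopology M d"
    using Z(1) unfolding completely_metrizable_space_def by blast
  then interpret Metric_space M d
    by blast
  have M: "topspace Z = M"
    by (simp add: Zeq)
  obtain \<B> where \<B>: "countable \<B>" "\<And>V. V \<in> \<B> \<Longrightarrow> openin Z V"
    and base: "\<And>U x. \<lbrakk>openin Z U; x \<in> U\<rbrakk> \<Longrightarrow> \<exists>V\<in>\<B>. x \<in> V \<and> V \<subseteq> U"
    using second_countable_baseE[OF Z(2)] by metis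
  define c where "c W = X closure_of (f ` W)" for W
  define child where "child W n = {V \<in> \<B>. V \<subseteq> W \<and> (\<exists>a. V \<subseteq> mball a (1 / real (Suc n)))}" for W n
  define D where "D W n = c W - (\<Union>V\<in>child W n. X interior_of (c V))" for W n
  have f_top: "f ` W \<subseteq> topspace X" if "W \<subseteq> M" for W
    using that f M continuous_map_image_subset_topspace by blast
  have D_nd: "nowhere_dense_in X (D W n)" if W: "openin Z W" for W n
  proof -
    have D_closed: "closedin X (D W n)"
      unfolding D_def c_def by (intro closedin_diff closedin_closure_of openin_Union) auto
    have "X interior_of (D W n) = {}"
    proof (rule ccontr)
      assume nonempty: "X interior_of (D W n) \<noteq> {}"
      define V where "V = X interior_of (D W n)"
      have V: "openin X V" "V \<noteq> {}" "V \<subseteq> D W n"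
        unfolding V_def by (rule openin_interior_of nonempty interior_of_subset)+
      \<comment> \<open>The parameters in \<open>W\<close> that are mapped into \<open>V\<close> form a non-empty open set with meager image.\<close>
      define O' where "O' = W \<inter> {z \<in> topspace Z. f z \<in> V}"
      have "openin Z O'"
        unfolding O'_def by (intro openin_Int W openin_continuous_map_preimage[OF f V(1)])
      moreover have "O' \<noteq> {}"
      proof -
        obtain y where "y \<in> V" "y \<in> X closure_of (f ` W)"
          using V(2,3) unfolding D_def c_def by blast
        then obtain z where "z \<in> W" "f z \<in> V"
          using V(1) unfolding in_closure_of by blast
        then show ?thesis
          using W openin_subset unfolding O'_def by fast
      qed
      moreover have "meager_in X (f ` O')"
      proof (rule meager_in_subset)
        show "meager_in X (\<Union>V'\<in>child W n. c V' - X interior_of (c V'))"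
          by (intro meager_in_UN nowhere_dense_imp_meager_in closed_minus_interior_nowhere_dense)
            (use \<B>(1) in \<open>auto simp: child_def c_def\<close>)
        show "f ` O' \<subseteq> (\<Union>V'\<in>child W n. c V' - X interior_of (c V'))"
        proof (rule image_subsetI)
          fix z assume z: "z \<in> O'"
          have zM: "z \<in> M"
            using z M unfolding O'_def by blast
          have op: "openin Z (W \<inter> mball z (1 / real (Suc n)))"
            using W unfolding Zeq by (intro openin_Int) auto
          have "z \<in> W \<inter> mball z (1 / real (Suc n))"
            using z zM by (simp add: O'_def del: of_nat_Suc)
          then obtain V' where V': "V' \<in> \<B>" "z \<in> V'" "V' \<subseteq> W \<inter> mball z (1 / real (Suc n))"
            using base[OF op] by blast
          then have ch: "V' \<in> child W n"
            unfolding child_def by blast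
          have "f ` V' \<subseteq> topspace X"
            using V'(3) by (intro f_top) (use W openin_subset M in fast)
          then have "f z \<in> c V'"
            using V'(2) closure_of_subset unfolding c_def by fast
          moreover have "f z \<notin> X interior_of (c V')"
            using z V(3) ch unfolding O'_def D_def by blast
          ultimately show "f z \<in> (\<Union>V'\<in>child W n. c V' - X interior_of (c V'))"
            using ch by blast
        qed
      qed
      ultimately show False
        using big by blast
    qed
    then show ?thesis
      using D_closed by (simp add: nowhere_dense_in_def closure_of_closedin closedin_subset)
  qed
  have "X closure_of (f ` topspace Z) - f ` topspace Z \<subseteq> (\<Union>W\<in>insert M \<B>. \<Union>n. D W n)"
  proof (rule ccontr)
    assume "\<not> ?thesis"
    then obtain x where x: "x \<in> c M" "x \<notin> f ` M" and "x \<notin> (\<Union>W\<in>insert M \<B>. \<Union>n. D W n)"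
      unfolding M c_def[symmetric] subset_iff by auto
    then have good: "x \<notin> D W n" if "W \<in> insert M \<B>" for W n
      using that by blast
    have "\<exists>W. \<forall>n. (W n \<in> insert M \<B> \<and> x \<in> c (W n)) \<and> W (Suc n) \<in> child (W n) n"
    proof (rule dependent_nat_choice)
      show "\<exists>W. W \<in> insert M \<B> \<and> x \<in> c W"
        using x(1) by blast
      fix W n assume "W \<in> insert M \<B> \<and> x \<in> c W"
      then obtain V where "V \<in> child W n" "x \<in> X interior_of (c V)"
        using good[of W n] unfolding D_def by blast
      then show "\<exists>V. (V \<in> insert M \<B> \<and> x \<in> c V) \<and> V \<in> child W n"
        using interior_of_subset unfolding child_def by fast
    qed
    then obtain W where W: "\<And>n. x \<in> c (W n)" "\<And>n. W n \<in> insert M \<B>"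
      and chain: "\<And>n. W (Suc n) \<in> child (W n) n"
      by blast
    have dec: "decseq W"
      using chain unfolding decseq_Suc_iff child_def by blast
    have WM: "W n \<subseteq> M" for n
      using W(2)[of n] \<B>(2) openin_subset M by auto
    have diam: "d y z < 2 / real (Suc n)" if yz: "y \<in> W (Suc n)" "z \<in> W (Suc n)" for n y z
    proof -
      obtain a where "W (Suc n) \<subseteq> mball a (1 / real (Suc n))"
        using chain[of n] unfolding child_def by blast
      then have a: "a \<in> M" "y \<in> M" "z \<in> M" "d a y < 1 / real (Suc n)" "d a z < 1 / real (Suc n)"
        using yz by (auto simp del: of_nat_Suc)
      have "d y z \<le> d a y + d a z"
        using triangle[of y a z] a(1-3) commute by simp
      moreover have "1 / real (Suc n) + 1 / real (Suc n) = 2 / real (Suc n)"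
        by simp
      ultimately show ?thesis
        using a(4,5) by linarith
    qed
    have "\<exists>y. y \<in> W n" for n
      using W(1)[of n] unfolding c_def by (cases "W n = {}") auto
    then obtain s where s: "\<And>n. s n \<in> W n"
      by metis
    have small: "\<exists>n. 2 / real (Suc n) < r" if "r > 0" for r
    proof -
      obtain n where "1 / real (Suc n) < r / 2"
        using \<open>r > 0\<close> by (meson half_gt_zero nat_approx_posE)
      then show ?thesis
        by (intro exI[of _ n]) (simp add: field_simps)
    qed
    have s_in: "s m \<in> W n" if "n \<le> m" for m n
      using decseqD[OF dec that] s by blast
    have "MCauchy s"
      unfolding MCauchy_def
    proof (intro conjI allI impI)
      show "range s \<subseteq> M"
        using s WM by blast
      fix r :: real assume "r > 0"
      then obtain n where n: "2 / real (Suc n) < r"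
        using small by blast
      have "d (s i) (s j) < r" if "Suc n \<le> i" "Suc n \<le> j" for i j
        using diam[OF s_in[OF that(1)] s_in[OF that(2)]] n by simp
      then show "\<exists>N. \<forall>i j. N \<le> i \<longrightarrow> N \<le> j \<longrightarrow> d (s i) (s j) < r"
        by blast
    qed
    then obtain z where lim: "limitin mtopology s z sequentially"
      using complete unfolding mcomplete_def by blast
    then have zM: "z \<in> M"
      using limitin_mspace by blast
    have "f z \<noteq> x"
      using x(2) zM by blast
    moreover have "f z \<in> topspace X" "x \<in> topspace X"
      using f_top[of "{z}"] zM x(1) by (auto simp: c_def in_closure_of)
    ultimately obtain U V where UV: "openin X U" "openin X V" "f z \<in> U" "x \<in> V" "disjnt U V"
      using X unfolding Hausdorff_space_def by blast
    have "openin mtopology {y \<in> topspace Z. f y \<in> U}"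
      using openin_continuous_map_preimage[OF f UV(1)] unfolding Zeq .
    moreover have "z \<in> {y \<in> topspace Z. f y \<in> U}"
      using zM M UV(3) by blast
    ultimately obtain r where r: "r > 0" "mball z r \<subseteq> {y \<in> topspace Z. f y \<in> U}"
      unfolding openin_mtopology by blast
    obtain n where n: "2 / real (Suc n) < r / 2"
      using small[of "r / 2"] r(1) by auto
    obtain N where N: "\<And>k. N \<le> k \<Longrightarrow> d (s k) z < r / 2"
      using lim r(1) unfolding limit_metric_sequentially by (meson half_gt_zero)
    define k where "k = max N (Suc n)"
    \<comment> \<open>The sets need not contain their limit point \<open>z\<close>, only to lie close to it.\<close>
    have "W (Suc n) \<subseteq> mball z r"
    proof
      fix y assume y: "y \<in> W (Suc n)"
      have sk: "s k \<in> W (Suc n)" "d (s k) z < r / 2"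
        using s_in N by (auto simp: k_def)
      have "d (s k) y < r / 2"
        using diam[OF sk(1) y] n by simp
      moreover have "d z y \<le> d (s k) z + d (s k) y"
        using triangle[of z "s k" y] commute[of z "s k"] zM y sk(1) WM by auto
      ultimately show "y \<in> mball z r"
        using sk(2) zM y WM by auto
    qed
    then have "f ` W (Suc n) \<subseteq> U"
      using r(2) by blast
    moreover obtain y where "y \<in> f ` W (Suc n)" "y \<in> V"
      using W(1)[of "Suc n"] UV(2,4) unfolding c_def in_closure_of by blast
    ultimately show False
      using UV(5) unfolding disjnt_def by blast
  qed
  moreover have "meager_in X (\<Union>W\<in>insert M \<B>. \<Union>n. D W n)"
  proof (intro meager_in_UN nowhere_dense_imp_meager_in D_nd)
    show "countable (insert M \<B>)"
      using \<B>(1) by simp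
    show "openin Z W" if "W \<in> insert M \<B>" for W
      using that \<B>(2) M by (metis insertE openin_topspace)
  qed auto
  ultimately show ?thesis
    by (rule meager_in_subset[rotated])
qed

section \<open>Topological groups\<close>

context topological_group
begin

lemma continuous_map_group_mult:
  assumes "continuous_map X T a" "continuous_map X T b"
  shows "continuous_map X T (\<lambda>x. a x \<otimes> b x)"
proof -
  have "continuous_map X (prod_topology T T) (\<lambda>x. (a x, b x))"
    using assms by (simp add: continuous_map_pairedI)
  from continuous_map_compose[OF this continuous_mult] show ?thesis
    by (simp add: o_def)
qed

lemma closedin_right_translate_preimage:
  assumes "continuous_map T T a" "p \<in> carrier G" "closedin T N"
  shows "closedin T {y \<in> carrier G. a y \<otimes> p \<in> N}"
  using closedin_continuous_map_preimage[OF continuous_map_group_mult[OF assms(1), of "\<lambda>_. p"] assms(3)]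
    assms(2) topspace_eq_carrier by simp

lemma closedin_left_translate_preimage:
  assumes "g \<in> carrier G" "closedin T N"
  shows "closedin T {y \<in> carrier G. g \<otimes> y \<in> N}"
  using closedin_continuous_map_preimage[OF continuous_map_group_mult[of T "\<lambda>_. g" "\<lambda>y. y"] assms(2)]
    assms(1) topspace_eq_carrier by simp

lemma homeomorphic_map_left_translate:
  assumes g: "g \<in> carrier G"
  shows "homeomorphic_map T T (\<lambda>y. g \<otimes> y)"
proof (rule homeomorphic_maps_imp_map)
  have cont: "continuous_map T T (\<lambda>y. h \<otimes> y)" if "h \<in> carrier G" for h
    using continuous_map_group_mult[of T "\<lambda>_. h" "\<lambda>y. y"] that topspace_eq_carrier by simp
  show "homeomorphic_maps T T (\<lambda>y. g \<otimes> y) (\<lambda>y. inv g \<otimes> y)"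
    unfolding homeomorphic_maps_def
    using g cont by (auto simp: topspace_eq_carrier m_assoc[symmetric])
qed

lemma pm_set_carrier: "A \<subseteq> carrier G \<Longrightarrow> pm_set G A \<subseteq> carrier G"
  unfolding pm_set_def SET_INV_def by auto

lemma list_set_mult_carrier:
  "(\<And>A. A \<in> set As \<Longrightarrow> A \<subseteq> carrier G) \<Longrightarrow> list_set_mult G As \<subseteq> carrier G"
proof (induction As)
  case Nil
  then show ?case by (simp add: list_set_mult_def)
next
  case (Cons A As)
  then show ?case
    using set_mult_closed[of A "list_set_mult G As"] by (simp add: list_set_mult_def)
qed

section \<open>Meager quasi-analytic subgroups\<close>

text \<open>
  The closed cover is arbitrary because the induction replaces it by translates. The sets are taken
  from a fixed countable base so that there are only countably many candidate lists. Passing to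
  closures costs nothing: the set of group elements admissible as first factor is closed, so it
  contains the closure of \<open>f V\<close> as soon as it contains \<open>f V\<close>.
\<close>

lemma pm_product_of_closures_in_closed_cover:
  fixes Z :: "'z topology" and N :: "nat \<Rightarrow> 'a set"
  assumes H: "subgroup H G" and Z: "Baire_space Z" "topspace Z \<noteq> {}"
    and \<B>: "countable \<B>" "\<And>V. V \<in> \<B> \<Longrightarrow> openin Z V"
    and base: "\<And>U x. \<lbrakk>openin Z U; x \<in> U\<rbrakk> \<Longrightarrow> \<exists>V\<in>\<B>. x \<in> V \<and> V \<subseteq> U"
    and f: "continuous_map Z T f" "f ` topspace Z \<subseteq> H"
    and N: "incseq N" "\<And>k. closedin T (N k)" "H \<subseteq> (\<Union>k. N k)"
  shows "\<exists>Vs k. Vs \<in> lists (\<B> - {{}}) \<and> length Vs = n \<and>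
           list_set_mult G (map (\<lambda>V. pm_set G (T closure_of (f ` V))) Vs) \<subseteq> N k"
  using N
proof (induction n arbitrary: N)
  case 0
  have "\<one> \<in> H"
    using H subgroup.one_closed by blast
  then obtain k where "\<one> \<in> N k"
    using 0 by blast
  then show ?case
    by (intro exI[of _ "[]"] exI[of _ k]) (simp add: list_set_mult_def)
next
  case (Suc n)
  define P where "P Vs = list_set_mult G (map (\<lambda>V. pm_set G (T closure_of (f ` V))) Vs)" for Vs
  have P_carrier: "P Vs \<subseteq> carrier G" for Vs
    unfolding P_def
  proof (rule list_set_mult_carrier)
    fix A assume "A \<in> set (map (\<lambda>V. pm_set G (T closure_of (f ` V))) Vs)"
    then obtain V where "A = pm_set G (T closure_of (f ` V))"
      by auto
    then show "A \<subseteq> carrier G"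
      using pm_set_carrier closure_of_subset_topspace[of T] topspace_eq_carrier by simp
  qed
  \<comment> \<open>\<open>E Vs k\<close> consists of the admissible first factors for the tail \<open>Vs\<close> and the target \<open>N k\<close>.\<close>
  define E where "E Vs k = {a \<in> carrier G. \<forall>p\<in>P Vs. a \<otimes> p \<in> N k \<and> inv a \<otimes> p \<in> N k}" for Vs k
  have E_closed: "closedin T (E Vs k)" for Vs k
  proof -
    have "E Vs k = carrier G \<inter>
        (\<Inter>p\<in>P Vs. {a \<in> carrier G. a \<otimes> p \<in> N k} \<inter> {a \<in> carrier G. inv a \<otimes> p \<in> N k})"
      unfolding E_def by blast
    also have "closedin T \<dots>"
    proof (cases "P Vs = {}")
      case True
      then show ?thesis
        using closedin_topspace[of T] topspace_eq_carrier by simp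
    next
      case False
      have "closedin T (carrier G)"
        using closedin_topspace[of T] topspace_eq_carrier by simp
      then show ?thesis
        using False P_carrier Suc.prems(2) continuous_inv
        by (intro closedin_Int closedin_Inter closedin_right_translate_preimage) 
           (auto intro!: closedin_Int closedin_right_translate_preimage)
    qed
    finally show ?thesis .
  qed
  define F where "F = (\<lambda>(Vs, k). {z \<in> topspace Z. f z \<in> E Vs k})"
  have cover: "topspace Z \<subseteq> (\<Union>j \<in> (lists (\<B> - {{}}) \<inter> {Vs. length Vs = n}) \<times> UNIV. F j)"
  proof
    fix z assume z: "z \<in> topspace Z"
    \<comment> \<open>A product with first factors \<open>f z\<close> and its inverse lies in \<open>N k\<close> iff its tail lies in \<open>N' k\<close>;
      the sets \<open>N' k\<close> still cover \<open>H\<close> because the sets \<open>N k\<close> increase.\<close>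
    define N' where "N' k = {y \<in> carrier G. f z \<otimes> y \<in> N k} \<inter> {y \<in> carrier G. inv (f z) \<otimes> y \<in> N k}" for k
    have fz: "f z \<in> H" "inv (f z) \<in> H" "f z \<in> carrier G"
      using z f(2) H subgroup.m_inv_closed subgroup.mem_carrier by fast+
    have "incseq N'"
      using Suc.prems(1) unfolding incseq_def N'_def by blast
    moreover have "closedin T (N' k)" for k
      unfolding N'_def using fz(3) Suc.prems(2)
      by (intro closedin_Int closedin_left_translate_preimage) auto
    moreover have "H \<subseteq> (\<Union>k. N' k)"
    proof
      fix h assume h: "h \<in> H"
      have "f z \<otimes> h \<in> H" "inv (f z) \<otimes> h \<in> H"
        using h fz H subgroup.m_closed by fast+
      then obtain i j where "f z \<otimes> h \<in> N i" "inv (f z) \<otimes> h \<in> N j"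
        using Suc.prems(3) by blast
      then have "f z \<otimes> h \<in> N (max i j)" "inv (f z) \<otimes> h \<in> N (max i j)"
        using incseqD[OF Suc.prems(1)] by (meson max.cobounded1 max.cobounded2 subsetD)+
      then show "h \<in> (\<Union>k. N' k)"
        unfolding N'_def using h H subgroup.mem_carrier by fast
    qed
    ultimately obtain Vs k where "Vs \<in> lists (\<B> - {{}})" "length Vs = n" "P Vs \<subseteq> N' k"
      using Suc.IH[of N'] unfolding P_def by blast
    moreover from this have "z \<in> F (Vs, k)"
      using z fz(3) unfolding F_def E_def N'_def by blast
    ultimately show "z \<in> (\<Union>j \<in> (lists (\<B> - {{}}) \<inter> {Vs. length Vs = n}) \<times> UNIV. F j)"
      by blast
  qed
  have "countable ((lists (\<B> - {{}}) \<inter> {Vs. length Vs = n}) \<times> (UNIV :: nat set))"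
    using \<B>(1) by (intro countable_SIGMA countable_Int1 countable_lists) auto
  moreover have "closedin Z (F j)" for j
    unfolding F_def by (cases j) (simp add: closedin_continuous_map_preimage[OF f(1) E_closed])
  ultimately obtain j where j: "j \<in> (lists (\<B> - {{}}) \<inter> {Vs. length Vs = n}) \<times> (UNIV :: nat set)"
    "Z interior_of (F j) \<noteq> {}"
    by (rule Baire_space_countable_closed_cover[OF Z _ _ cover])
  obtain Vs k where "j = (Vs, k)"
    by (cases j)
  with j have Vs: "Vs \<in> lists (\<B> - {{}})" "length Vs = n" and int: "Z interior_of (F (Vs, k)) \<noteq> {}"
    by simp_all
  then obtain z where "z \<in> Z interior_of (F (Vs, k))"
    by blast
  then obtain V where V: "V \<in> \<B>" "z \<in> V" "V \<subseteq> Z interior_of (F (Vs, k))"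
    using base by (meson openin_interior_of)
  have "f ` V \<subseteq> E Vs k"
    using V(3) interior_of_subset[of Z "F (Vs, k)"] unfolding F_def by blast
  then have "T closure_of (f ` V) \<subseteq> E Vs k"
    using E_closed by (rule closure_of_minimal)
  then have "pm_set G (T closure_of (f ` V)) <#> P Vs \<subseteq> N k"
    unfolding pm_set_def SET_INV_def set_mult_def E_def by blast
  then have "P (V # Vs) \<subseteq> N k"
    unfolding P_def list_set_mult_def by simp
  moreover have "V # Vs \<in> lists (\<B> - {{}})" "length (V # Vs) = Suc n"
    using V Vs by auto
  ultimately show ?case
    unfolding P_def by blast
qed

lemma meager_quasi_analytic_subgroup_in_ideal:
  fixes Z :: "'z topology"
  assumes I: "set_sigma_ideal (carrier G) I" "closed_pm_Steinhaus G T n I"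
    and H: "subgroup H G" "meager_in T H"
    and Z: "hereditarily_Baire_space Z" "second_countable Z"
    and f: "continuous_map Z T f" "f ` topspace Z = H"
  shows "H \<in> I"
proof (rule ccontr)
  assume "H \<notin> I"
  obtain C where C: "closedin Z C" "f ` (topspace Z - C) \<in> I"
    and big: "\<And>V. \<lbrakk>openin (subtopology Z C) V; f ` V \<in> I\<rbrakk> \<Longrightarrow> V = {}"
    using sigma_ideal_kernel[OF I(1) Z(2)] by blast
  have top: "topspace (subtopology Z C) = C"
    using closedin_subset[OF C(1)] by auto
  have "C \<noteq> {}"
    using C(2) f(2) \<open>H \<notin> I\<close> by auto
  obtain \<B> where \<B>: "countable \<B>" "\<And>V. V \<in> \<B> \<Longrightarrow> openin (subtopology Z C) V"
    and base: "\<And>U x. \<lbrakk>openin (subtopology Z C) U; x \<in> U\<rbrakk> \<Longrightarrow> \<exists>V\<in>\<B>. x \<in> V \<and> V \<subseteq> U"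
    using second_countable_baseE[OF second_countable_subtopology[OF Z(2), of C]] by metis
  obtain N where N: "incseq N" "\<And>k. closedin T (N k)" "\<And>k. nowhere_dense_in T (N k)" "H \<subseteq> (\<Union>k. N k)"
    using meager_in_increasing_closed_cover[OF H(2)] by blast
  have "Baire_space (subtopology Z C)"
    using Z(1) C(1) unfolding hereditarily_Baire_space_def by blast
  moreover have "f ` topspace (subtopology Z C) \<subseteq> H"
    using f(2) by (auto simp: topspace_subtopology)
  ultimately obtain Vs k where Vs: "Vs \<in> lists (\<B> - {{}})" "length Vs = n"
    and sub: "list_set_mult G (map (\<lambda>V. pm_set G (T closure_of (f ` V))) Vs) \<subseteq> N k"
    using pm_product_of_closures_in_closed_cover[OF H(1) _ _ \<B> base
        continuous_map_from_subtopology[OF f(1)] _ N(1,2,4), of n] \<open>C \<noteq> {}\<close> top by auto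
  define As where "As = map (\<lambda>V. T closure_of (f ` V)) Vs"
  have "\<forall>A\<in>set As. closedin T A \<and> A \<notin> I"
  proof
    fix A assume "A \<in> set As"
    then obtain V where V: "V \<in> \<B>" "V \<noteq> {}" and A: "A = T closure_of (f ` V)"
      using Vs(1) unfolding As_def by auto
    have "f ` V \<subseteq> A"
      unfolding A
      using openin_subset[OF \<B>(2)[OF V(1)]] f(1)
      by (intro closure_of_subset) (auto simp: continuous_map_def)
    then have "A \<notin> I"
      using big[OF \<B>(2)[OF V(1)]] V(2) set_sigma_ideal_subset[OF I(1)] by blast
    then show "closedin T A \<and> A \<notin> I"
      by (simp add: A)
  qed
  moreover have "length As = n"
    using Vs(2) by (simp add: As_def)
  ultimately have big_product: "\<not> nowhere_dense_in T (list_set_mult G (map (pm_set G) As))"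
    using I(2) unfolding closed_pm_Steinhaus_def by blast
  have "map (pm_set G) As = map (\<lambda>V. pm_set G (T closure_of (f ` V))) Vs"
    by (simp add: As_def)
  then have "list_set_mult G (map (pm_set G) As) \<subseteq> N k"
    using sub by (simp only:)
  then have "nowhere_dense_in T (list_set_mult G (map (pm_set G) As))"
    by (rule nowhere_dense_in_subset[OF N(3)])
  with big_product show False
    by (rule notE)
qed

section \<open>Non-meager analytic subgroups\<close>

text \<open>
  Let \<open>C\<close> be the kernel for the meager ideal and \<open>U\<close> the interior of the closure of \<open>f C\<close>. Every
  non-empty open \<open>V \<subseteq> U\<close> meets \<open>f C\<close> in a non-meager set, while \<open>U - f C\<close> is meager. Fix
  \<open>u \<in> U \<inter> H\<close>. For \<open>u' \<in> U\<close> and \<open>g = u' u\<^sup>-\<^sup>1\<close> the open set \<open>U \<inter> g U\<close> contains \<open>u'\<close>, so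
  the non-meager set \<open>f C \<inter> U \<inter> g U\<close> is not contained in the meager set \<open>g (U - f C)\<close>. Hence
  \<open>f C\<close> meets \<open>g (f C)\<close>, and \<open>g\<close> is a quotient of elements of \<open>H\<close>. Thus \<open>u' = g u \<in> H\<close>, and
  \<open>H\<close> contains \<open>U\<close>.
\<close>

lemma nonmeager_analytic_subgroup_open:
  fixes Z :: "'z topology"
  assumes T: "Hausdorff_space T" and H: "subgroup H G" "\<not> meager_in T H"
    and Z: "completely_metrizable_space Z" "second_countable Z"
    and f: "continuous_map Z T f" "f ` topspace Z = H"
  shows "openin T H"
proof -
  obtain C where C: "closedin Z C" "meager_in T (f ` (topspace Z - C))"
    and big: "\<And>V. \<lbrakk>openin (subtopology Z C) V; meager_in T (f ` V)\<rbrakk> \<Longrightarrow> V = {}"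
    using sigma_ideal_kernel[OF meager_sigma_ideal[of T] Z(2)] by (metis mem_Collect_eq)
  have top: "topspace (subtopology Z C) = C"
    using closedin_subset[OF C(1)] by auto
  have fC: "continuous_map (subtopology Z C) T f"
    by (rule continuous_map_from_subtopology[OF f(1)])
  have CZ: "C \<subseteq> topspace Z"
    using C(1) closedin_subset by blast
  have AH: "f ` C \<subseteq> H"
    using CZ f(2) by blast
  have HG: "H \<subseteq> carrier G"
    using H(1) subgroup.subset by blast
  have almost_closed: "meager_in T (T closure_of (f ` C) - f ` C)"
    using nonmeager_parametrization_almost_closed[OF completely_metrizable_space_closedin[OF Z(1) C(1)]
        second_countable_subtopology[OF Z(2)] T fC big] unfolding top .
  have "\<not> meager_in T (f ` C)"
  proof
    assume "meager_in T (f ` C)"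
    then have "meager_in T (f ` C \<union> f ` (topspace Z - C))"
      using C(2) meager_in_Un by blast
    moreover have "f ` C \<union> f ` (topspace Z - C) = H"
      using CZ f(2) by blast
    ultimately show False
      using H(2) by simp
  qed
  then have nonempty: "T interior_of (T closure_of (f ` C)) \<noteq> {}"
    using nowhere_dense_imp_meager_in AH HG topspace_eq_carrier unfolding nowhere_dense_in_def by blast
  define U where "U = T interior_of (T closure_of (f ` C))"
  have U: "openin T U" "U \<noteq> {}" "U \<subseteq> T closure_of (f ` C)"
    unfolding U_def by (rule openin_interior_of nonempty interior_of_subset)+
  have UG: "U \<subseteq> carrier G"
    using U(1) openin_subset topspace_eq_carrier by blast
  have meets: "\<exists>z\<in>C. f z \<in> V" if V: "openin T V" "V \<noteq> {}" "V \<subseteq> U" for V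
    using V U(3) by (auto simp: in_closure_of subset_iff)
  obtain u where u: "u \<in> U" "u \<in> H"
    using meets[OF U(1,2)] AH by blast
  have "U \<subseteq> H"
  proof
    fix u' assume u': "u' \<in> U"
    define g where "g = u' \<otimes> inv u"
    have g: "g \<in> carrier G" "g \<otimes> u = u'"
      using u u' UG by (auto simp: g_def m_assoc subset_iff)
    define V where "V = U \<inter> (\<lambda>y. g \<otimes> y) ` U"
    have "openin T V"
      unfolding V_def using U(1) homeomorphic_map_left_translate[OF g(1)]
      by (intro openin_Int) (use homeomorphic_imp_open_map open_map_def in blast)+
    moreover have "u' \<in> V"
      unfolding V_def using u' u(1) g(2) by blast
    ultimately obtain z where z: "z \<in> C" "f z \<in> V"
      using meets[of V] unfolding V_def by blast
    have "openin (subtopology Z C) {z \<in> topspace (subtopology Z C). f z \<in> V}"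
      by (rule openin_continuous_map_preimage[OF fC \<open>openin T V\<close>])
    then have "\<not> meager_in T (f ` {z \<in> C. f z \<in> V})"
      using big z unfolding top by blast
    moreover have "meager_in T ((\<lambda>y. g \<otimes> y) ` (U - f ` C))"
    proof (rule homeomorphic_map_meager_in[OF homeomorphic_map_left_translate[OF g(1)]])
      show "meager_in T (U - f ` C)"
        by (rule meager_in_subset[OF almost_closed]) (use U(3) in blast)
    qed
    ultimately have "\<not> f ` {z \<in> C. f z \<in> V} \<subseteq> (\<lambda>y. g \<otimes> y) ` (U - f ` C)"
      using meager_in_subset[of T "(\<lambda>y. g \<otimes> y) ` (U - f ` C)"] by (rule_tac notI) simp
    then obtain w where w: "w \<in> C" "f w \<in> V" "f w \<notin> (\<lambda>y. g \<otimes> y) ` (U - f ` C)"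
      by (auto simp: image_subset_iff)
    define y where "y = f w"
    have "y \<in> f ` C"
      unfolding y_def using w(1) by (rule imageI)
    obtain a where "a \<in> U" "y = g \<otimes> a"
      using w(2) unfolding V_def y_def by (elim IntE imageE)
    with w(3) have a: "a \<in> f ` C" "y = g \<otimes> a"
      unfolding y_def by auto
    have yH: "y \<in> H" "a \<in> H"
      using AH \<open>y \<in> f ` C\<close> a(1) by blast+
    have "g = y \<otimes> inv a"
      using a(2) g(1) yH HG by (auto simp: m_assoc subset_iff)
    then have "g \<in> H"
      using yH H(1) by (simp add: subgroup.m_closed subgroup.m_inv_closed)
    then show "u' \<in> H"
      using g(2) u(2) H(1) subgroup.m_closed by metis
  qed
  \<comment> \<open>A subgroup containing a non-empty open set is a union of translates of that set.\<close>
  have "openin T W \<Longrightarrow> g \<in> carrier G \<Longrightarrow> openin T ((\<lambda>y. g \<otimes> y) ` W)" for g W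
    using homeomorphic_map_left_translate homeomorphic_imp_open_map open_map_def by blast
  then have "openin T (\<Union>h\<in>H. (\<lambda>y. (h \<otimes> inv u) \<otimes> y) ` U)"
    using U(1) u HG by (intro openin_Union) (auto simp: subset_iff)
  also have "(\<Union>h\<in>H. (\<lambda>y. (h \<otimes> inv u) \<otimes> y) ` U) = H"
  proof
    show "(\<Union>h\<in>H. (\<lambda>y. (h \<otimes> inv u) \<otimes> y) ` U) \<subseteq> H"
      using \<open>U \<subseteq> H\<close> u(2) H(1) by (auto intro!: subgroup.m_closed subgroup.m_inv_closed)
    show "H \<subseteq> (\<Union>h\<in>H. (\<lambda>y. (h \<otimes> inv u) \<otimes> y) ` U)"
    proof
      fix h assume h: "h \<in> H"
      then have "h = (h \<otimes> inv u) \<otimes> u"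
        using u HG by (auto simp: m_assoc subset_iff)
      then show "h \<in> (\<Union>h\<in>H. (\<lambda>y. (h \<otimes> inv u) \<otimes> y) ` U)"
        using h u(1) by blast
    qed
  qed
  finally show ?thesis .
qed

end

theorem theorem3p9:
  fixes G :: "('a, 'b) monoid_scheme" and T :: "'a topology"
    and n :: nat and I :: "'a set set"
  assumes "topological_group G T"
    and "n \<ge> 1"
    and "set_sigma_ideal (carrier G) I"
    and "closed_pm_Steinhaus G T n I"
  shows "(\<forall>H. subgroup H G \<and> meager_in T H \<and>
              quasi_analytic_space TYPE('y) (subtopology T H) \<longrightarrow> H \<in> I) \<and>
         (Hausdorff_space T \<longrightarrow>
           (\<forall>H. subgroup H G \<and> \<not> openin T H \<and>
              analytic_space TYPE('z) (subtopology T H) \<longrightarrow> H \<in> I))"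
proof -
  interpret topological_group G T
    by (rule assms(1))
  have param: "\<exists>f. continuous_map Z T f \<and> f ` topspace Z = H"
    if "subgroup H G" "continuous_image_of (subtopology T H) Z" for H and Z :: "'w topology"
  proof -
    have "topspace (subtopology T H) = H"
      using subgroup.subset[OF that(1)] topspace_eq_carrier by auto
    then show ?thesis
      using that(2) unfolding continuous_image_of_def by (metis continuous_map_in_subtopology)
  qed
  have "H \<in> I" if H: "subgroup H G" "meager_in T H" "quasi_analytic_space TYPE('y) (subtopology T H)" for H
  proof -
    obtain Z :: "'y topology" where Z: "hereditarily_Baire_space Z" "metrizable_space Z"
      "separable_space Z" "continuous_image_of (subtopology T H) Z"
      using H(3) unfolding quasi_analytic_space_def by blast
    obtain f where "continuous_map Z T f" "f ` topspace Z = H"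
      using param[OF H(1) Z(4)] by blast
    then show ?thesis
      using meager_quasi_analytic_subgroup_in_ideal[OF assms(3,4) H(1,2) Z(1)
          separable_metrizable_imp_second_countable[OF Z(2,3)]] by blast
  qed
  moreover
  have "H \<in> I" if T: "Hausdorff_space T" and H: "subgroup H G" "\<not> openin T H"
    "analytic_space TYPE('z) (subtopology T H)" for H
  proof -
    obtain Z :: "'z topology" where Z: "Polish_space Z" "continuous_image_of (subtopology T H) Z"
      using H(3) unfolding analytic_space_def by blast
    obtain f where f: "continuous_map Z T f" "f ` topspace Z = H"
      using param[OF H(1) Z(2)] by blast
    have Z': "completely_metrizable_space Z" "second_countable Z"
      using Z(1) separable_metrizable_imp_second_countable completely_metrizable_imp_metrizable_space
      unfolding Polish_space_def by blast+
    have "meager_in T H"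
      using nonmeager_analytic_subgroup_open[OF T H(1) _ Z' f] H(2) by blast
    then show ?thesis
      using meager_quasi_analytic_subgroup_in_ideal[OF assms(3,4) H(1) _
          Polish_imp_hereditarily_Baire[OF Z(1)] Z'(2) f] by blast
  qed
  ultimately show ?thesis
    by (intro conjI allI impI) simp_all
qed

end
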